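(* Let $A=(A_b,A_w)$ be a pairwise comparison system, and let $D_1,D_2,\epsilon_i,\epsilon_{i,j}$ (computed from $A$) and $\eta_A$ be as defined in the context. In what follows $A'=(A_b',A_w')$ denotes a pairwise comparison system on the same criteria with the same best and worst criteria, with entries $a'_{bi},a'_{iw}$. Then the following statements hold. 1. If $\eta_A=\epsilon_{i_0}$ for some $i_0\in D_1$, then for any PCS $A'$ such that $a_{bi_0}'=a_{bi_0}$, $a_{i_0w}'=a_{i_0w}$, $a_{bw}'=a_{bw}$, $\eta_{A'}=\eta_A=\epsilon_{i_0}$ and $$\min\left\{a_{iw}'+\epsilon_{i_0},\frac{a_{bw}'}{a_{bi}'}\right\}=\min\left\{a_{iw}+\epsilon_{i_0},\frac{a_{bw}}{a_{bi}}\right\}\quad\text{for all } i\in D\setminus\{i_0\},$$ both the optimal weight set and the optimal objective value of the linear best-worst problem (P) for $A'$ coincide with those for $A$. 2. If $\eta_A=\epsilon_{j_0}$ for some $j_0\in D_2$, then for any PCS $A'$ such that $a_{bj_0}'=a_{bj_0}$, $a_{j_0w}'=a_{j_0w}$, $a_{bw}'=a_{bw}$, $\eta_{A'}=\eta_A=\epsilon_{j_0}$ and $$\min\left\{a_{iw}'+\epsilon_{j_0},\frac{a_{bw}'+2\epsilon_{j_0}}{a_{bi}'}\right\}=\min\left\{a_{iw}+\epsilon_{j_0},\frac{a_{bw}+2\epsilon_{j_0}}{a_{bi}}\right\}\quad\text{for all } i\in D\setminus\{j_0\},$$ both the optimal weight set and the optimal objective value of (P) for $A'$ coincide with those for $A$.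 3. If $\eta_A=\epsilon_{i_0,j_0}$ for some $i_0\in D_1$ and $j_0\in D_2$, then for any PCS $A'$ such that $a_{bi_0}'=a_{bi_0}$, $a_{i_0w}'=a_{i_0w}$, $a_{bj_0}'=a_{bj_0}$, $a_{j_0w}'=a_{j_0w}$, $a_{bw}'=a_{bw}$, $\eta_{A'}=\eta_A=\epsilon_{i_0,j_0}$ and $$\min\left\{a_{iw}'+\epsilon_{i_0,j_0},\frac{a_{bi_0}'a_{i_0w}'+(a_{bi_0}'+2)\epsilon_{i_0,j_0}}{a_{bi}'}\right\}=\min\left\{a_{iw}+\epsilon_{i_0,j_0},\frac{a_{bi_0}a_{i_0w}+(a_{bi_0}+2)\epsilon_{i_0,j_0}}{a_{bi}}\right\}\quad\text{for all } i\in D\setminus\{i_0,j_0\},$$ both the optimal weight set and the optimal objective value of (P) for $A'$ coincide with those for $A$.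
   Context: Let $C=\{1,2,\ldots,n\}$ with $n\geq 3$ index the decision criteria, let $b,w\in C$ with $b\neq w$ be the (indices of the) best and worst criteria, and let $D=C\setminus\{b,w\}$. A pairwise comparison system (PCS) is a pair $A=(A_b,A_w)$ with $A_b=(a_{b1},\ldots,a_{bn})$ and $A_w=(a_{1w},\ldots,a_{nw})^T$, where all entries are positive real numbers, $a_{bb}=a_{ww}=1$, and the entry $a_{bw}$ is common to both vectors. For a PCS $A$ define $$D_1=\{i\in D: a_{bi}a_{iw}<a_{bw}\},\quad D_2=\{i\in D: a_{bi}a_{iw}>a_{bw}\},$$ $$\epsilon_i=\frac{|a_{bi}a_{iw}-a_{bw}|}{a_{bi}+2},\quad \epsilon_{i,j}=\frac{|a_{bi}a_{iw}-a_{bj}a_{jw}|}{a_{bi}+a_{bj}+2}\quad (i,j\in D),$$ $$\eta_A=\max\{\epsilon_i,\epsilon_{j,k}: i\in D,\ j\in D_1,\ k\in D_2\}.$$ The quantity $\eta_{A'}$ is defined in the same way from the entries of $A'$. Problem (P), the linear best-worst problem for a PCS $A$: minimize $\epsilon$ subject to $|w_b-a_{bi}w_i|\leq\epsilon$, $|w_i-a_{iw}w_w|\leq\epsilon$ for all $i\in D$, $|w_b-a_{bw}w_w|\leq\epsilon$, $w_1+\cdots+w_n=1$ and $w_j\geq 0$ for all $j\in C$. The optimal weight set is the (unique) family $\{w_1,\ldots,w_n\}$ of optimal weights. *)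

theory Defs
  imports Complex_Main "HOL-Library.FuncSet"
begin

text \<open>
  Criteria are the indices in \<open>{1..n}\<close>; \<open>b\<close> and \<open>w\<close> are the best and the worst criterion.
  In a pairwise comparison system \<open>A\<close>, \<open>best_to A i\<close> is the entry \<open>a\<^sub>b\<^sub>i\<close> and
  \<open>to_worst A i\<close> is the entry \<open>a\<^sub>i\<^sub>w\<close>; values outside \<open>{1..n}\<close> are irrelevant.
\<close>

record pcs =
  best_to :: "nat \<Rightarrow> real"
  to_worst :: "nat \<Rightarrow> real"

text \<open>The entry \<open>a\<^sub>b\<^sub>w\<close> occurs in both vectors, hence the last conjunct.\<close>

definition is_pcs :: "nat \<Rightarrow> nat \<Rightarrow> nat \<Rightarrow> pcs \<Rightarrow> bool" where
  "is_pcs n b w A \<longleftrightarrow>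
     (\<forall>i\<in>{1..n}. best_to A i > 0 \<and> to_worst A i > 0) \<and>
     best_to A b = 1 \<and> to_worst A w = 1 \<and> best_to A w = to_worst A b"

definition D :: "nat \<Rightarrow> nat \<Rightarrow> nat \<Rightarrow> nat set" where
  "D n b w = {1..n} - {b, w}"

definition D1 :: "nat \<Rightarrow> nat \<Rightarrow> nat \<Rightarrow> pcs \<Rightarrow> nat set" where
  "D1 n b w A = {i \<in> D n b w. best_to A i * to_worst A i < best_to A w}"

definition D2 :: "nat \<Rightarrow> nat \<Rightarrow> nat \<Rightarrow> pcs \<Rightarrow> nat set" where
  "D2 n b w A = {i \<in> D n b w. best_to A i * to_worst A i > best_to A w}"

definition eps :: "nat \<Rightarrow> pcs \<Rightarrow> nat \<Rightarrow> real" where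
  "eps w A i = \<bar>best_to A i * to_worst A i - best_to A w\<bar> / (best_to A i + 2)"

definition eps2 :: "pcs \<Rightarrow> nat \<Rightarrow> nat \<Rightarrow> real" where
  "eps2 A i j = \<bar>best_to A i * to_worst A i - best_to A j * to_worst A j\<bar>
                  / (best_to A i + best_to A j + 2)"

definition eta :: "nat \<Rightarrow> nat \<Rightarrow> nat \<Rightarrow> pcs \<Rightarrow> real" where
  "eta n b w A = Max ({eps w A i | i. i \<in> D n b w} \<union>
                      {eps2 A j k | j k. j \<in> D1 n b w A \<and> k \<in> D2 n b w A})"

text \<open>
  The linear best-worst problem, in the variables \<open>u\<close> (weights) and \<open>e\<close> (objective).
  Weights are total functions made extensional outside \<open>{1..n}\<close>, so that equality of weight
  functions is equality of the families \<open>u 1, \<dots>, u n\<close>.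
\<close>

definition feasible :: "nat \<Rightarrow> nat \<Rightarrow> nat \<Rightarrow> pcs \<Rightarrow> (nat \<Rightarrow> real) \<Rightarrow> real \<Rightarrow> bool" where
  "feasible n b w A u e \<longleftrightarrow>
     u \<in> extensional {1..n} \<and>
     (\<forall>i\<in>D n b w. \<bar>u b - best_to A i * u i\<bar> \<le> e \<and> \<bar>u i - to_worst A i * u w\<bar> \<le> e) \<and>
     \<bar>u b - best_to A w * u w\<bar> \<le> e \<and>
     (\<Sum>j=1..n. u j) = 1 \<and>
     (\<forall>j\<in>{1..n}. u j \<ge> 0)"

definition optimal :: "nat \<Rightarrow> nat \<Rightarrow> nat \<Rightarrow> pcs \<Rightarrow> (nat \<Rightarrow> real) \<Rightarrow> real \<Rightarrow> bool" where
  "optimal n b w A u e \<longleftrightarrow>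
     feasible n b w A u e \<and> (\<forall>u' e'. feasible n b w A u' e' \<longrightarrow> e \<le> e')"

text \<open>
  All optimal weight families. No uniqueness is built into the definition; when the optimal
  family is unique, this is the singleton containing it.
\<close>

definition opt_weights :: "nat \<Rightarrow> nat \<Rightarrow> nat \<Rightarrow> pcs \<Rightarrow> (nat \<Rightarrow> real) set" where
  "opt_weights n b w A = {u. \<exists>e. optimal n b w A u e}"

definition opt_value :: "nat \<Rightarrow> nat \<Rightarrow> nat \<Rightarrow> pcs \<Rightarrow> real" where
  "opt_value n b w A = Inf {e. \<exists>u. feasible n b w A u e}"

lemma opt_value_eq: "optimal n b w A u e \<Longrightarrow> opt_value n b w A = e"
  unfolding opt_value_def optimal_def by (rule cInf_eq_minimum) auto

end

theory Submission
  imports Defs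
begin

text \<open>
  Measure all weights in units of \<open>u w\<close>: with \<open>x\<^sub>j = u j / u w\<close> and \<open>t = e / u w\<close> the
  constraints become \<open>\<bar>x\<^sub>b - a\<^sub>b\<^sub>w\<bar> \<le> t\<close>, \<open>\<bar>x\<^sub>i - a\<^sub>i\<^sub>w\<bar> \<le> t\<close> and \<open>\<bar>x\<^sub>b - a\<^sub>b\<^sub>i x\<^sub>i\<bar> \<le> t\<close>.
  A suitable \<open>x\<^sub>i\<close> exists iff \<open>\<bar>x\<^sub>b - a\<^sub>b\<^sub>i a\<^sub>i\<^sub>w\<bar> \<le> (a\<^sub>b\<^sub>i + 1) t\<close>, so the ratio \<open>x\<^sub>b\<close> has to lie in an
  intersection of intervals that grow with \<open>t\<close>. The numbers \<open>\<epsilon>\<^sub>i\<close> and \<open>\<epsilon>\<^sub>i\<^sub>,\<^sub>j\<close> are the levels at which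
  two of these intervals first meet; the intervals of two criteria that are not on opposite sides of
  \<open>a\<^sub>b\<^sub>w\<close> meet no later than they both meet the interval around \<open>a\<^sub>b\<^sub>w\<close>. So \<open>\<eta>\<close> is the level at which the
  intersection becomes nonempty; there it is a single point \<open>z\<close>, an endpoint of the two intervals
  whose meeting level is \<open>\<eta>\<close>. This situation is \<open>rigid_ratio\<close>, and the three cases of the theorem are the three
  possibilities for the two intervals (\<open>rigid_ratio_D1\<close>, \<open>rigid_ratio_D2\<close>, \<open>rigid_ratio_D1_D2\<close>).

  Problem (P) minimises \<open>e = t / (x\<^sub>1 + \<dots> + x\<^sub>n)\<close> rather than \<open>t\<close>, so raising \<open>t\<close> above \<open>\<eta>\<close> in order
  to enlarge the sum has to be excluded. All upper bounds on the \<open>x\<^sub>j\<close> are minima of affine functions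
  of \<open>t\<close> with nonnegative constant terms, hence grow at most proportionally to \<open>t\<close>. If \<open>X\<^sub>j\<close> is the
  largest value of \<open>x\<^sub>j\<close> at level \<open>\<eta>\<close>, every feasible pair therefore satisfies
  \<open>u j \<le> X\<^sub>j e / \<eta>\<close> (\<open>feasible_le_profile\<close>, in a form without division by \<open>u w\<close>, which may vanish).
  Summation over \<open>j\<close> gives \<open>e \<ge> \<eta> / (X\<^sub>1 + \<dots> + X\<^sub>n)\<close>,
  and equality forces \<open>u\<close> to be the normalisation of \<open>X\<close>, which is feasible. Thus the optimum is a
  function of \<open>\<eta>\<close>, \<open>z\<close> and the numbers \<open>X\<^sub>i = min (a\<^sub>i\<^sub>w + \<eta>) ((z + \<eta>) / a\<^sub>b\<^sub>i)\<close>, and these are the data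
  that the hypotheses on \<open>A'\<close> preserve.
\<close>

section \<open>The optimum when the best-to-worst ratio is forced\<close>

text \<open>
  The two bounds on absolute values say that \<open>z\<close> is an admissible value of \<open>u b / u w\<close> at level \<open>h\<close>.
  The two disjunctions say that some interval ends at \<open>z\<close> and some interval begins there, so \<open>z\<close> is
  the only admissible ratio and none exists below level \<open>h\<close>.
\<close>

definition rigid_ratio :: "nat \<Rightarrow> nat \<Rightarrow> nat \<Rightarrow> pcs \<Rightarrow> real \<Rightarrow> real \<Rightarrow> bool" where
  "rigid_ratio n b w A h z \<longleftrightarrow>
     h > 0 \<and>
     \<bar>z - best_to A w\<bar> \<le> h \<and>
     (\<forall>i\<in>D n b w. \<bar>z - best_to A i * to_worst A i\<bar> \<le> (best_to A i + 1) * h) \<and>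
     (z = best_to A w + h \<or>
       (\<exists>i\<in>D n b w. z = best_to A i * to_worst A i + (best_to A i + 1) * h)) \<and>
     (z = best_to A w - h \<or>
       (\<exists>i\<in>D n b w. z = best_to A i * to_worst A i - (best_to A i + 1) * h))"

definition max_profile :: "nat \<Rightarrow> nat \<Rightarrow> pcs \<Rightarrow> real \<Rightarrow> real \<Rightarrow> nat \<Rightarrow> real" where
  "max_profile b w A h z i =
     (if i = w then 1 else if i = b then z
      else min (to_worst A i + h) ((z + h) / best_to A i))"

lemma D_entries_pos:
  assumes "is_pcs n b w A" "i \<in> D n b w"
  shows "best_to A i > 0" "to_worst A i > 0"
  using assms by (auto simp: is_pcs_def D_def)

lemma best_to_worst_pos:
  assumes "is_pcs n b w A" "w \<in> {1..n}"
  shows "best_to A w > 0"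
  using assms unfolding is_pcs_def by blast

lemma feasible_best_bounds:
  assumes "is_pcs n b w A" "feasible n b w A u e" "i \<in> D n b w"
  shows "\<bar>u b - best_to A i * to_worst A i * u w\<bar> \<le> (best_to A i + 1) * e"
proof -
  have pos: "best_to A i > 0" using D_entries_pos assms by blast
  have 1: "\<bar>u b - best_to A i * u i\<bar> \<le> e" and "\<bar>u i - to_worst A i * u w\<bar> \<le> e"
    using assms by (auto simp: feasible_def)
  then have "best_to A i * \<bar>u i - to_worst A i * u w\<bar> \<le> best_to A i * e"
    using pos by (intro mult_left_mono) auto
  moreover have "best_to A i * \<bar>u i - to_worst A i * u w\<bar>
      = \<bar>best_to A i * u i - best_to A i * to_worst A i * u w\<bar>"
    using pos by (simp add: abs_mult_pos' algebra_simps)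
  ultimately show ?thesis using 1 by (simp add: algebra_simps)
qed

text \<open>
  The interval ending at \<open>z\<close> bounds \<open>u b\<close> above and the interval beginning at \<open>z\<close> bounds it below;
  comparing the two bounds eliminates \<open>u b\<close>.
\<close>

lemma feasible_worst_le:
  assumes pcs: "is_pcs n b w A" and rigid: "rigid_ratio n b w A h z"
    and feas: "feasible n b w A u e"
  shows "h * u w \<le> e"
proof -
  have bound0: "\<bar>u b - best_to A w * u w\<bar> \<le> e" using feas by (auto simp: feasible_def)
  note bounds = feasible_best_bounds[OF pcs feas]
  have h: "h > 0" using rigid by (simp add: rigid_ratio_def)
  have "\<exists>p \<alpha>. \<alpha> > 0 \<and> z = p + \<alpha> * h \<and> u b \<le> p * u w + \<alpha> * e"
  proof (cases "z = best_to A w + h")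
    case True
    then show ?thesis using bound0 by (intro exI[of _ "best_to A w"] exI[of _ 1]) auto
  next
    case False
    then obtain i where i: "i \<in> D n b w"
      "z = best_to A i * to_worst A i + (best_to A i + 1) * h"
      using rigid by (auto simp: rigid_ratio_def)
    then show ?thesis using bounds[of i] D_entries_pos[OF pcs, of i]
      by (intro exI[of _ "best_to A i * to_worst A i"] exI[of _ "best_to A i + 1"]) auto
  qed
  then obtain p \<alpha> where up: "\<alpha> > 0" "z = p + \<alpha> * h" "u b \<le> p * u w + \<alpha> * e" by blast
  have "\<exists>q \<beta>. \<beta> > 0 \<and> z = q - \<beta> * h \<and> u b \<ge> q * u w - \<beta> * e"
  proof (cases "z = best_to A w - h")
    case True
    then show ?thesis using bound0 by (intro exI[of _ "best_to A w"] exI[of _ 1]) auto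
  next
    case False
    then obtain i where i: "i \<in> D n b w"
      "z = best_to A i * to_worst A i - (best_to A i + 1) * h"
      using rigid by (auto simp: rigid_ratio_def)
    then show ?thesis using bounds[of i] D_entries_pos[OF pcs, of i]
      by (intro exI[of _ "best_to A i * to_worst A i"] exI[of _ "best_to A i + 1"]) auto
  qed
  then obtain q \<beta> where low: "\<beta> > 0" "z = q - \<beta> * h" "u b \<ge> q * u w - \<beta> * e" by blast
  have "q = p + (\<alpha> + \<beta>) * h" using up low by (simp add: algebra_simps)
  then have "(\<alpha> + \<beta>) * (h * u w) \<le> (\<alpha> + \<beta>) * e"
    using up low by (simp add: algebra_simps)
  then show ?thesis using up low by (simp add: mult_le_cancel_left)
qed

text \<open>
  This is the step that compares different levels: each upper bound has the form
  \<open>p * u w + \<alpha> * e\<close> with \<open>p \<ge> 0\<close>, and \<open>u w \<le> e / h\<close> turns it into \<open>(p + \<alpha> * h) * e / h\<close>, the bound of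
  level \<open>h\<close> scaled by \<open>e / h\<close>.
\<close>

lemma feasible_le_profile:
  assumes pcs: "is_pcs n b w A" and rigid: "rigid_ratio n b w A h z"
    and b: "b \<in> {1..n}" and w: "w \<in> {1..n}" and "b \<noteq> w"
    and feas: "feasible n b w A u e" and j: "j \<in> {1..n}"
  shows "u j \<le> max_profile b w A h z j * (e / h)"
proof -
  have h: "h > 0" using rigid by (simp add: rigid_ratio_def)
  have uw: "u w \<le> e / h"
    using feasible_worst_le[OF pcs rigid feas] h by (simp add: field_simps)
  have scale: "p * u w + \<alpha> * e \<le> (p + \<alpha> * h) * (e / h)" if "p \<ge> 0" for p \<alpha>
    using mult_left_mono[OF uw that] h by (simp add: algebra_simps)
  have ub: "u b \<le> z * (e / h)"
  proof (cases "z = best_to A w + h")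
    case True
    have "best_to A w \<ge> 0" using best_to_worst_pos[OF pcs w] by simp
    moreover have "u b \<le> best_to A w * u w + 1 * e" using feas by (auto simp: feasible_def)
    ultimately show ?thesis using scale[of "best_to A w" 1] True by simp
  next
    case False
    then obtain i where i: "i \<in> D n b w"
      "z = best_to A i * to_worst A i + (best_to A i + 1) * h"
      using rigid by (auto simp: rigid_ratio_def)
    have "u b \<le> best_to A i * to_worst A i * u w + (best_to A i + 1) * e"
      using feasible_best_bounds[OF pcs feas i(1)] by linarith
    also have "\<dots> \<le> z * (e / h)"
      unfolding i(2) using D_entries_pos[OF pcs i(1)] by (intro scale) simp_all
    finally show ?thesis .
  qed
  show ?thesis
  proof (cases "j = w \<or> j = b")
    case True
    then show ?thesis using uw ub \<open>b \<noteq> w\<close> by (auto simp: max_profile_def)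
  next
    case False
    then have jD: "j \<in> D n b w" using j by (auto simp: D_def)
    note pos = D_entries_pos[OF pcs jD]
    have 1: "u j \<le> (to_worst A j + h) * (e / h)"
    proof -
      have "u j \<le> to_worst A j * u w + 1 * e" using feas jD by (fastforce simp: feasible_def)
      then show ?thesis using scale[of "to_worst A j" 1] pos by simp
    qed
    have 2: "u j \<le> ((z + h) / best_to A j) * (e / h)"
    proof -
      have "best_to A j * u j \<le> u b + e" using feas jD by (fastforce simp: feasible_def)
      also have "\<dots> \<le> (z + h) * (e / h)" using ub h by (simp add: field_simps)
      finally have "u j \<le> (z + h) * (e / h) / best_to A j"
        by (simp only: pos_le_divide_eq[OF pos(1)] mult.commute)
      then show ?thesis by (simp add: mult.commute)
    qed
    show ?thesis using 1 2 False by (auto simp: max_profile_def min_def)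
  qed
qed

text \<open>
  The interval conditions on \<open>z\<close> are used here for the existence of optimal weights: they are
  equivalent to compatibility of the lower bounds on each \<open>x\<^sub>i\<close> with the upper bound chosen by
  \<open>max_profile\<close>.
\<close>

lemma profile_feasible:
  fixes X :: "nat \<Rightarrow> real" and S :: real
  assumes pcs: "is_pcs n b w A" and rigid: "rigid_ratio n b w A h z"
    and b: "b \<in> {1..n}" and w: "w \<in> {1..n}" and "b \<noteq> w"
  defines "X \<equiv> max_profile b w A h z"
  defines "S \<equiv> (\<Sum>j=1..n. X j)"
  shows "S > 0" and "feasible n b w A (\<lambda>i\<in>{1..n}. X i / S) (h / S)"
proof -
  have h: "h > 0" using rigid by (simp add: rigid_ratio_def)
  have z: "z > 0"
  proof -
    have "best_to A w > 0" using best_to_worst_pos[OF pcs w] .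
    then show ?thesis
      using rigid D_entries_pos[OF pcs] h
      by (auto simp: rigid_ratio_def intro!: add_pos_pos mult_pos_pos)
  qed
  have Xw: "X w = 1" and Xb: "X b = z" using \<open>b \<noteq> w\<close> by (auto simp: X_def max_profile_def)
  have XD: "X i = min (to_worst A i + h) ((z + h) / best_to A i)" if "i \<in> D n b w" for i
    using that by (auto simp: X_def max_profile_def D_def)
  have X_pos: "X i > 0" if "i \<in> {1..n}" for i
  proof (cases "i = w \<or> i = b")
    case False
    then have "i \<in> D n b w" using that by (auto simp: D_def)
    then show ?thesis using XD D_entries_pos[OF pcs] h z by (simp add: add_pos_pos)
  qed (use Xw Xb z in auto)
  show S: "S > 0" unfolding S_def using b X_pos by (intro sum_pos) auto
  have dev_b: "\<bar>z - best_to A w\<bar> \<le> h" using rigid by (simp add: rigid_ratio_def)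
  have dev: "\<bar>z - best_to A i * X i\<bar> \<le> h" "\<bar>X i - to_worst A i\<bar> \<le> h" if i: "i \<in> D n b w" for i
  proof -
    note pos = D_entries_pos[OF pcs i]
    have "\<bar>z - best_to A i * to_worst A i\<bar> \<le> (best_to A i + 1) * h"
      using rigid i by (simp add: rigid_ratio_def)
    then have lo: "z - h \<le> best_to A i * (to_worst A i + h)"
      and hi: "best_to A i * (to_worst A i - h) \<le> z + h"
      by (auto simp: algebra_simps abs_le_iff)
    have hi': "to_worst A i - h \<le> (z + h) / best_to A i"
      using hi pos by (simp add: field_simps)
    have *: "best_to A i * X i = min (best_to A i * (to_worst A i + h)) (z + h)"
      using XD[OF i] pos by (simp add: min_mult_distrib_left)
    show "\<bar>z - best_to A i * X i\<bar> \<le> h" using * lo h by (auto simp: min_def)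
    show "\<bar>X i - to_worst A i\<bar> \<le> h" using XD[OF i] hi' h by (auto simp: min_def)
  qed
  have scale: "\<bar>x / S - c * (y / S)\<bar> \<le> h / S" if "\<bar>x - c * y\<bar> \<le> h" for x y c
  proof -
    have "x / S - c * (y / S) = (x - c * y) / S" by (simp add: diff_divide_distrib)
    then have "\<bar>x / S - c * (y / S)\<bar> = \<bar>x - c * y\<bar> / S" using S by simp
    then show ?thesis using that S by (simp add: divide_right_mono)
  qed
  have "(\<Sum>j=1..n. X j / S) = 1"
    using S by (simp add: sum_divide_distrib[symmetric] S_def)
  moreover have "\<bar>X b / S - best_to A w * (X w / S)\<bar> \<le> h / S"
    using dev_b Xw Xb by (intro scale) simp
  moreover have "\<bar>X b / S - best_to A i * (X i / S)\<bar> \<le> h / S"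
    "\<bar>X i / S - to_worst A i * (X w / S)\<bar> \<le> h / S" if "i \<in> D n b w" for i
    using scale[of "X b" "best_to A i" "X i"] scale[of "X i" "to_worst A i" "X w"]
      dev[OF that] Xw Xb by simp_all
  moreover have "X i / S \<ge> 0" if "i \<in> {1..n}" for i
    using X_pos[OF that] S by simp
  moreover have "i \<in> {1..n}" if "i \<in> D n b w" for i using that by (simp add: D_def)
  ultimately show "feasible n b w A (\<lambda>i\<in>{1..n}. X i / S) (h / S)"
    using b w by (auto simp: feasible_def)
qed

text \<open>
  Summing \<open>u j \<le> X j * (e / h)\<close> bounds \<open>e\<close> from below. At the optimal value the two sides have equal
  sums, so every single inequality is an equality.
\<close>

lemma optimum_of_rigid_ratio:
  fixes X :: "nat \<Rightarrow> real" and S :: real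
  assumes pcs: "is_pcs n b w A" and rigid: "rigid_ratio n b w A h z"
    and b: "b \<in> {1..n}" and w: "w \<in> {1..n}" and "b \<noteq> w"
  defines "X \<equiv> max_profile b w A h z"
  defines "S \<equiv> (\<Sum>j=1..n. X j)"
  shows "opt_weights n b w A = {\<lambda>i\<in>{1..n}. X i / S}" and "opt_value n b w A = h / S"
proof -
  have h: "h > 0" using rigid by (simp add: rigid_ratio_def)
  note feasX = profile_feasible[OF pcs rigid b w \<open>b \<noteq> w\<close>, folded X_def, folded S_def]
  note S = feasX(1)
  note le = feasible_le_profile[OF pcs rigid b w \<open>b \<noteq> w\<close>, folded X_def]
  have e_ge: "h / S \<le> e" if feas: "feasible n b w A u e" for u e
  proof -
    have "1 = (\<Sum>j=1..n. u j)" using feas by (simp add: feasible_def)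
    also have "\<dots> \<le> (\<Sum>j=1..n. X j * (e / h))" using le[OF feas] by (intro sum_mono) auto
    also have "\<dots> = S * (e / h)" by (simp only: S_def sum_distrib_right)
    finally show ?thesis using h S by (simp add: field_simps)
  qed
  have optX: "optimal n b w A (\<lambda>i\<in>{1..n}. X i / S) (h / S)"
    using feasX(2) e_ge by (auto simp: optimal_def)
  then show least: "opt_value n b w A = h / S" by (rule opt_value_eq)
  have "u = (\<lambda>i\<in>{1..n}. X i / S)" if opt: "optimal n b w A u e" for u e
  proof -
    have e: "e = h / S" using opt_value_eq[OF opt] least by simp
    have feas: "feasible n b w A u e" using opt by (simp add: optimal_def)
    have u_le: "u j \<le> X j / S" if "j \<in> {1..n}" for j
      using le[OF feas that] e h by simp
    have "(\<Sum>j=1..n. u j) = 1" using feas by (simp add: feasible_def)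
    moreover have "(\<Sum>j=1..n. X j / S) = 1"
      using S by (simp add: sum_divide_distrib[symmetric] S_def)
    ultimately have "(\<Sum>j=1..n. X j / S - u j) = 0" by (simp add: sum_subtractf)
    then have "\<forall>j\<in>{1..n}. X j / S - u j = 0"
      using u_le by (subst (asm) sum_nonneg_eq_0_iff) auto
    moreover have "u \<in> extensional {1..n}" using feas by (simp add: feasible_def)
    ultimately show ?thesis by (intro ext) (auto simp: extensional_def)
  qed
  then show "opt_weights n b w A = {\<lambda>i\<in>{1..n}. X i / S}"
    using optX unfolding opt_weights_def by blast
qed

text \<open>
  For \<open>i \<in> D n b w\<close> the optimum sees the comparisons \<open>a\<^sub>b\<^sub>i\<close> and \<open>a\<^sub>i\<^sub>w\<close> only through the minimum that
  defines \<open>max_profile\<close>; this is where the minima in the theorem come from.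
\<close>

lemma optimum_eq_of_rigid_ratio:
  assumes "is_pcs n b w A" "is_pcs n b w A'"
    and "rigid_ratio n b w A h z" "rigid_ratio n b w A' h z"
    and "b \<in> {1..n}" "w \<in> {1..n}" "b \<noteq> w"
    and same: "\<And>i. i \<in> D n b w \<Longrightarrow>
        min (to_worst A' i + h) ((z + h) / best_to A' i)
      = min (to_worst A i + h) ((z + h) / best_to A i)"
  shows "opt_weights n b w A' = opt_weights n b w A \<and> opt_value n b w A' = opt_value n b w A"
proof -
  have X: "max_profile b w A' h z i = max_profile b w A h z i" if "i \<in> {1..n}" for i
    using same[of i] that by (auto simp: max_profile_def D_def)
  then have S: "(\<Sum>i=1..n. max_profile b w A' h z i) = (\<Sum>i=1..n. max_profile b w A h z i)"
    by (intro sum.cong) auto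
  show ?thesis
    using optimum_of_rigid_ratio[OF assms(1,3,5-7)] optimum_of_rigid_ratio[OF assms(2,4,5-7)] X
    unfolding S by (auto intro!: restrict_ext)
qed

section \<open>The forced ratio at level \<open>\<eta>\<close>\<close>

lemma finite_eta_set:
  "finite ({eps w A i | i. i \<in> D n b w} \<union> {eps2 A j k | j k. j \<in> D1 n b w A \<and> k \<in> D2 n b w A})"
proof -
  have "{eps2 A j k | j k. j \<in> D1 n b w A \<and> k \<in> D2 n b w A}
      = (\<lambda>(j, k). eps2 A j k) ` (D1 n b w A \<times> D2 n b w A)" by auto
  then show ?thesis by (auto simp: D_def D1_def D2_def)
qed

lemma eps_le_eta: "i \<in> D n b w \<Longrightarrow> eps w A i \<le> eta n b w A"
  unfolding eta_def by (rule Max_ge[OF finite_eta_set]) blast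

lemma eps2_le_eta: "j \<in> D1 n b w A \<Longrightarrow> k \<in> D2 n b w A \<Longrightarrow> eps2 A j k \<le> eta n b w A"
  unfolding eta_def by (rule Max_ge[OF finite_eta_set]) blast

lemma eta_bound:
  assumes "is_pcs n b w A" "i \<in> D n b w"
  shows "\<bar>best_to A i * to_worst A i - best_to A w\<bar> \<le> (best_to A i + 2) * eta n b w A"
  using eps_le_eta[OF assms(2), of A] D_entries_pos[OF assms]
  by (simp add: eps_def pos_divide_le_eq mult.commute)

lemma eta_bound_pair:
  assumes "is_pcs n b w A" "j \<in> D1 n b w A" "k \<in> D2 n b w A"
  shows "best_to A k * to_worst A k - best_to A j * to_worst A j
      \<le> (best_to A j + best_to A k + 2) * eta n b w A"
proof -
  have "best_to A j > 0" "best_to A k > 0"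
    using assms D_entries_pos by (auto simp: D1_def D2_def)
  then have "\<bar>best_to A j * to_worst A j - best_to A k * to_worst A k\<bar>
      \<le> (best_to A j + best_to A k + 2) * eta n b w A"
    using eps2_le_eta[OF assms(2,3)] by (simp add: eps2_def pos_divide_le_eq mult.commute)
  then show ?thesis by linarith
qed

text \<open>
  Here the interval of \<open>i0\<close> ends where the interval around \<open>a\<^sub>b\<^sub>w\<close> begins. The pair bounds
  keep the lower endpoints of criteria in \<open>D\<^sub>2\<close> at or below this point, and the single bounds keep all
  upper endpoints at or above it.
\<close>

lemma rigid_ratio_D1:
  assumes pcs: "is_pcs n b w A" and i0: "i0 \<in> D1 n b w A"
    and eta: "eta n b w A = eps w A i0"
  shows "rigid_ratio n b w A (eps w A i0) (best_to A w - eps w A i0)"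
proof -
  define h where "h = eps w A i0"
  have i0D: "i0 \<in> D n b w" and lt: "best_to A i0 * to_worst A i0 < best_to A w"
    using i0 by (auto simp: D1_def)
  note pos0 = D_entries_pos[OF pcs i0D]
  have h: "h > 0" using lt pos0 by (auto simp: h_def eps_def intro!: divide_pos_pos)
  have meet: "best_to A w - best_to A i0 * to_worst A i0 = (best_to A i0 + 2) * h"
    using lt pos0 by (simp add: h_def eps_def)
  have "\<bar>best_to A w - h - best_to A i * to_worst A i\<bar> \<le> (best_to A i + 1) * h"
    if i: "i \<in> D n b w" for i
  proof -
    have "best_to A i * h > 0" using D_entries_pos[OF pcs i] h by simp
    moreover have "best_to A i * to_worst A i \<le> best_to A w + best_to A i * h"
    proof (cases "i \<in> D2 n b w A")
      case True
      from eta_bound_pair[OF pcs i0 this] show ?thesis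
        using meet by (simp add: eta h_def algebra_simps)
    next
      case False
      then show ?thesis using i \<open>best_to A i * h > 0\<close> by (simp add: D2_def)
    qed
    moreover note eta_bound[OF pcs i]
    ultimately show ?thesis by (simp add: eta flip: h_def) (simp add: algebra_simps abs_le_iff)
  qed
  moreover have "best_to A w - h = best_to A i0 * to_worst A i0 + (best_to A i0 + 1) * h"
    using meet by (simp add: algebra_simps)
  ultimately show ?thesis
    using h i0D unfolding rigid_ratio_def h_def[symmetric] by auto
qed

text \<open>
  Here the interval around \<open>a\<^sub>b\<^sub>w\<close> ends where the interval of \<open>j0\<close> begins; the roles of \<open>D\<^sub>1\<close> and
  \<open>D\<^sub>2\<close> are exchanged.
\<close>

lemma rigid_ratio_D2:
  assumes pcs: "is_pcs n b w A" and j0: "j0 \<in> D2 n b w A"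
    and eta: "eta n b w A = eps w A j0"
  shows "rigid_ratio n b w A (eps w A j0) (best_to A w + eps w A j0)"
proof -
  define h where "h = eps w A j0"
  have j0D: "j0 \<in> D n b w" and gt: "best_to A j0 * to_worst A j0 > best_to A w"
    using j0 by (auto simp: D2_def)
  note pos0 = D_entries_pos[OF pcs j0D]
  have h: "h > 0" using gt pos0 by (auto simp: h_def eps_def intro!: divide_pos_pos)
  have meet: "best_to A j0 * to_worst A j0 - best_to A w = (best_to A j0 + 2) * h"
    using gt pos0 by (simp add: h_def eps_def)
  have "\<bar>best_to A w + h - best_to A i * to_worst A i\<bar> \<le> (best_to A i + 1) * h"
    if i: "i \<in> D n b w" for i
  proof -
    have "best_to A i * h > 0" using D_entries_pos[OF pcs i] h by simp
    moreover have "best_to A w \<le> best_to A i * to_worst A i + best_to A i * h"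
    proof (cases "i \<in> D1 n b w A")
      case True
      from eta_bound_pair[OF pcs this j0] show ?thesis
        using meet by (simp add: eta h_def algebra_simps)
    next
      case False
      then show ?thesis using i \<open>best_to A i * h > 0\<close> by (simp add: D1_def)
    qed
    moreover note eta_bound[OF pcs i]
    ultimately show ?thesis by (simp add: eta flip: h_def) (simp add: algebra_simps abs_le_iff)
  qed
  moreover have "best_to A w + h = best_to A j0 * to_worst A j0 - (best_to A j0 + 1) * h"
    using meet by (simp add: algebra_simps)
  ultimately show ?thesis
    using h j0D unfolding rigid_ratio_def h_def[symmetric] by auto
qed

text \<open>
  Here the interval of \<open>i0\<close> ends where that of \<open>j0\<close> begins. The single bounds for \<open>i0\<close> and \<open>j0\<close> put
  this point within \<open>\<eta>\<close> of \<open>a\<^sub>b\<^sub>w\<close>. An upper endpoint below it could only belong to \<open>D\<^sub>1\<close>, which the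
  pair bound with \<open>j0\<close> excludes; a lower endpoint above it could only belong to \<open>D\<^sub>2\<close>, which the pair
  bound with \<open>i0\<close> excludes.
\<close>

lemma rigid_ratio_D1_D2:
  assumes pcs: "is_pcs n b w A" and i0: "i0 \<in> D1 n b w A" and j0: "j0 \<in> D2 n b w A"
    and eta: "eta n b w A = eps2 A i0 j0"
  shows "rigid_ratio n b w A (eps2 A i0 j0)
           (best_to A i0 * to_worst A i0 + (best_to A i0 + 1) * eps2 A i0 j0)"
proof -
  define h where "h = eps2 A i0 j0"
  define z where "z = best_to A i0 * to_worst A i0 + (best_to A i0 + 1) * h"
  have i0D: "i0 \<in> D n b w" and lt: "best_to A i0 * to_worst A i0 < best_to A w"
    using i0 by (auto simp: D1_def)
  have j0D: "j0 \<in> D n b w" and gt: "best_to A j0 * to_worst A j0 > best_to A w"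
    using j0 by (auto simp: D2_def)
  note pos = D_entries_pos[OF pcs i0D] D_entries_pos[OF pcs j0D]
  have h: "h > 0" using lt gt pos by (auto simp: h_def eps2_def intro!: divide_pos_pos)
  have "best_to A j0 * to_worst A j0 - best_to A i0 * to_worst A i0
      = (best_to A i0 + best_to A j0 + 2) * h"
    using lt gt pos by (simp add: h_def eps2_def)
  then have z_j0: "z = best_to A j0 * to_worst A j0 - (best_to A j0 + 1) * h"
    by (simp add: z_def algebra_simps)
  have z_ge: "best_to A w - h \<le> z"
    using eta_bound[OF pcs i0D] lt by (simp add: z_def eta algebra_simps flip: h_def)
  have z_le: "z \<le> best_to A w + h"
    using eta_bound[OF pcs j0D] gt by (simp add: z_j0 eta algebra_simps flip: h_def)
  have "\<bar>z - best_to A i * to_worst A i\<bar> \<le> (best_to A i + 1) * h"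
    if i: "i \<in> D n b w" for i
  proof -
    have "best_to A i * h > 0" using D_entries_pos[OF pcs i] h by simp
    have "z \<le> best_to A i * to_worst A i + (best_to A i + 1) * h"
    proof (cases "i \<in> D1 n b w A")
      case True
      from eta_bound_pair[OF pcs this j0] show ?thesis
        by (simp add: z_j0 eta algebra_simps flip: h_def)
    next
      case False
      then have "best_to A w \<le> best_to A i * to_worst A i" using i by (simp add: D1_def)
      then show ?thesis using z_le \<open>best_to A i * h > 0\<close> by (simp add: algebra_simps)
    qed
    moreover have "best_to A i * to_worst A i - (best_to A i + 1) * h \<le> z"
    proof (cases "i \<in> D2 n b w A")
      case True
      from eta_bound_pair[OF pcs i0 this] show ?thesis
        by (simp add: z_def eta algebra_simps flip: h_def)
    next
      case False
      then have "best_to A i * to_worst A i \<le> best_to A w" using i by (simp add: D2_def)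
      then show ?thesis using z_ge \<open>best_to A i * h > 0\<close> by (simp add: algebra_simps)
    qed
    ultimately show ?thesis by linarith
  qed
  then have "rigid_ratio n b w A h z"
    unfolding rigid_ratio_def
  proof (intro conjI disjI2)
    show "\<exists>i\<in>D n b w. z = best_to A i * to_worst A i + (best_to A i + 1) * h"
      using i0D z_def by blast
    show "\<exists>i\<in>D n b w. z = best_to A i * to_worst A i - (best_to A i + 1) * h"
      using j0D z_j0 by blast
  qed (use h z_ge z_le in auto)
  then show ?thesis by (simp add: z_def h_def)
qed

section \<open>Changing the comparisons without changing the optimum\<close>

theorem corollary1:
  fixes n b w :: nat and A :: pcs
  assumes "n \<ge> 3" and "b \<in> {1..n}" and "w \<in> {1..n}" and "b \<noteq> w"
    and "is_pcs n b w A"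
  shows
    "(\<forall>i0 \<in> D1 n b w A. eta n b w A = eps w A i0 \<longrightarrow>
       (\<forall>A'. is_pcs n b w A' \<and>
             best_to A' i0 = best_to A i0 \<and> to_worst A' i0 = to_worst A i0 \<and>
             best_to A' w = best_to A w \<and>
             eta n b w A' = eta n b w A \<and>
             (\<forall>i \<in> D n b w - {i0}.
                min (to_worst A' i + eps w A i0) (best_to A' w / best_to A' i)
              = min (to_worst A i + eps w A i0) (best_to A w / best_to A i))
         \<longrightarrow> opt_weights n b w A' = opt_weights n b w A \<and>
             opt_value n b w A' = opt_value n b w A))
   \<and> (\<forall>j0 \<in> D2 n b w A. eta n b w A = eps w A j0 \<longrightarrow>
       (\<forall>A'. is_pcs n b w A' \<and>
             best_to A' j0 = best_to A j0 \<and> to_worst A' j0 = to_worst A j0 \<and>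
             best_to A' w = best_to A w \<and>
             eta n b w A' = eta n b w A \<and>
             (\<forall>i \<in> D n b w - {j0}.
                min (to_worst A' i + eps w A j0)
                    ((best_to A' w + 2 * eps w A j0) / best_to A' i)
              = min (to_worst A i + eps w A j0)
                    ((best_to A w + 2 * eps w A j0) / best_to A i))
         \<longrightarrow> opt_weights n b w A' = opt_weights n b w A \<and>
             opt_value n b w A' = opt_value n b w A))
   \<and> (\<forall>i0 \<in> D1 n b w A. \<forall>j0 \<in> D2 n b w A. eta n b w A = eps2 A i0 j0 \<longrightarrow>
       (\<forall>A'. is_pcs n b w A' \<and>
             best_to A' i0 = best_to A i0 \<and> to_worst A' i0 = to_worst A i0 \<and>
             best_to A' j0 = best_to A j0 \<and> to_worst A' j0 = to_worst A j0 \<and>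
             best_to A' w = best_to A w \<and>
             eta n b w A' = eta n b w A \<and>
             (\<forall>i \<in> D n b w - {i0, j0}.
                min (to_worst A' i + eps2 A i0 j0)
                    ((best_to A' i0 * to_worst A' i0 + (best_to A' i0 + 2) * eps2 A i0 j0)
                       / best_to A' i)
              = min (to_worst A i + eps2 A i0 j0)
                    ((best_to A i0 * to_worst A i0 + (best_to A i0 + 2) * eps2 A i0 j0)
                       / best_to A i))
         \<longrightarrow> opt_weights n b w A' = opt_weights n b w A \<and>
             opt_value n b w A' = opt_value n b w A))"
proof -
  let ?goal = "\<lambda>A'. opt_weights n b w A' = opt_weights n b w A \<and>
                    opt_value n b w A' = opt_value n b w A"
  note pcs = \<open>is_pcs n b w A\<close>
  note transfer = optimum_eq_of_rigid_ratio[OF pcs _ _ _ assms(2-4)]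
  have case1: "?goal A'"
    if i0: "i0 \<in> D1 n b w A" and eta: "eta n b w A = eps w A i0"
      and pcs': "is_pcs n b w A'"
      and eq: "best_to A' i0 = best_to A i0" "to_worst A' i0 = to_worst A i0"
        "best_to A' w = best_to A w" and eta': "eta n b w A' = eta n b w A"
      and same: "\<forall>i \<in> D n b w - {i0}.
                min (to_worst A' i + eps w A i0) (best_to A' w / best_to A' i)
              = min (to_worst A i + eps w A i0) (best_to A w / best_to A i)" for i0 A'
  proof -
    have eps: "eps w A' i0 = eps w A i0" using eq by (simp add: eps_def)
    have i0': "i0 \<in> D1 n b w A'" using i0 eq by (simp add: D1_def)
    note rigid = rigid_ratio_D1[OF pcs i0 eta]
    have rigid': "rigid_ratio n b w A' (eps w A i0) (best_to A w - eps w A i0)"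
      using rigid_ratio_D1[OF pcs' i0'] eta eta' eps eq by simp
    show ?thesis
    proof (rule transfer[OF pcs' rigid rigid'], goal_cases)
      case (1 i)
      \<comment> \<open>In the minimum \<open>z + h\<close> cancels to \<open>a\<^sub>b\<^sub>w\<close>, the numerator in the hypothesis \<open>same\<close>.\<close>
      then show ?case using same eq by (cases "i = i0") auto
    qed
  qed
  have case2: "?goal A'"
    if j0: "j0 \<in> D2 n b w A" and eta: "eta n b w A = eps w A j0"
      and pcs': "is_pcs n b w A'"
      and eq: "best_to A' j0 = best_to A j0" "to_worst A' j0 = to_worst A j0"
        "best_to A' w = best_to A w" and eta': "eta n b w A' = eta n b w A"
      and same: "\<forall>i \<in> D n b w - {j0}.
                min (to_worst A' i + eps w A j0)
                    ((best_to A' w + 2 * eps w A j0) / best_to A' i)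
              = min (to_worst A i + eps w A j0)
                    ((best_to A w + 2 * eps w A j0) / best_to A i)" for j0 A'
  proof -
    have eps: "eps w A' j0 = eps w A j0" using eq by (simp add: eps_def)
    have j0': "j0 \<in> D2 n b w A'" using j0 eq by (simp add: D2_def)
    note rigid = rigid_ratio_D2[OF pcs j0 eta]
    have rigid': "rigid_ratio n b w A' (eps w A j0) (best_to A w + eps w A j0)"
      using rigid_ratio_D2[OF pcs' j0'] eta eta' eps eq by simp
    have sum: "best_to A w + eps w A j0 + eps w A j0 = best_to A w + 2 * eps w A j0" by simp
    show ?thesis
    proof (rule transfer[OF pcs' rigid rigid'], unfold sum, goal_cases)
      case (1 i)
      then show ?case using same eq by (cases "i = j0") auto
    qed
  qed
  have case3: "?goal A'"
    if i0: "i0 \<in> D1 n b w A" and j0: "j0 \<in> D2 n b w A"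
      and eta: "eta n b w A = eps2 A i0 j0" and pcs': "is_pcs n b w A'"
      and eq: "best_to A' i0 = best_to A i0" "to_worst A' i0 = to_worst A i0"
        "best_to A' j0 = best_to A j0" "to_worst A' j0 = to_worst A j0"
        "best_to A' w = best_to A w" and eta': "eta n b w A' = eta n b w A"
      and same: "\<forall>i \<in> D n b w - {i0, j0}.
                min (to_worst A' i + eps2 A i0 j0)
                    ((best_to A' i0 * to_worst A' i0 + (best_to A' i0 + 2) * eps2 A i0 j0)
                       / best_to A' i)
              = min (to_worst A i + eps2 A i0 j0)
                    ((best_to A i0 * to_worst A i0 + (best_to A i0 + 2) * eps2 A i0 j0)
                       / best_to A i)" for i0 j0 A'
  proof -
    define z where "z = best_to A i0 * to_worst A i0 + (best_to A i0 + 1) * eps2 A i0 j0"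
    have eps: "eps2 A' i0 j0 = eps2 A i0 j0" using eq by (simp add: eps2_def)
    have i0': "i0 \<in> D1 n b w A'" and j0': "j0 \<in> D2 n b w A'"
      using i0 j0 eq by (simp_all add: D1_def D2_def)
    have rigid: "rigid_ratio n b w A (eps2 A i0 j0) z"
      using rigid_ratio_D1_D2[OF pcs i0 j0 eta] by (simp add: z_def)
    have rigid': "rigid_ratio n b w A' (eps2 A i0 j0) z"
      using rigid_ratio_D1_D2[OF pcs' i0' j0'] eta eta' eps eq by (simp add: z_def)
    have sum: "z + eps2 A i0 j0
        = best_to A i0 * to_worst A i0 + (best_to A i0 + 2) * eps2 A i0 j0"
      by (simp add: z_def algebra_simps)
    show ?thesis
    proof (rule transfer[OF pcs' rigid rigid'], unfold sum, goal_cases)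
      case (1 i)
      then show ?case using same eq by (cases "i = i0 \<or> i = j0") auto
    qed
  qed
  show ?thesis
    using case1 case2 case3 by (intro conjI[OF _ conjI] ballI impI allI) blast+
qed

end
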